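(* Let $m\geq 3$ and $h\geq 1$ be integers with $(m,h)\notin\{(3,1),(4,1)\}$, let $n=m^h$, and let $\overline{\Gamma_{m^h}}=\overline{C_{m^h}(1,m,m^2,\ldots,m^{h-1})}$ be the complement of the circulant graph $C_{m^h}(1,m,m^2,\ldots,m^{h-1})$. Then its distance spectral radius is $$\rho(\overline{\Gamma_{m^h}})=n+2h-1.$$
   Context: For $S\subseteq\mathbb{Z}_n\setminus\{0\}$, the circulant graph $C_n(S)$ is the simple undirected graph with vertex set $\mathbb{Z}_n=\{0,1,\ldots,n-1\}$ and edge set $\{\{g,g+s\}: g\in\mathbb{Z}_n, s\in S\}$ (addition mod $n$); $C_n(s_1,\ldots,s_t)$ means $C_n(\{s_1,\ldots,s_t\})$. $\overline{\Gamma}$ denotes the complement of $\Gamma$. For a connected graph $\Gamma$ with vertices $v_1,\ldots,v_n$, the distance matrix $\mathbf{D}(\Gamma)$ is the $n\times n$ matrix with $(i,j)$-entry $d_{\Gamma}(v_i,v_j)$, the length of a shortest path between $v_i$ and $v_j$ ($0$ if $i=j$). The distance spectral radius $\rho(\Gamma)$ is the largest eigenvalue of $\mathbf{D}(\Gamma)$. *)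

theory Defs
  imports "Graph_Theory.Graph_Theory" "Jordan_Normal_Form.Spectral_Radius"
begin

text \<open>
  A simple undirected graph is represented, as in the \<^locale>\<open>pair_graph\<close> locale, by its vertex
  set together with a finite, symmetric, irreflexive set of ordered pairs: the edge
  \<open>{u, v}\<close> corresponds to the two arcs \<open>(u, v)\<close> and \<open>(v, u)\<close>.
\<close>

text \<open>The connection set \<open>S\<close> is a set of residues represented in \<open>{1..<n}\<close>.\<close>

definition circulant_graph :: "nat \<Rightarrow> nat set \<Rightarrow> nat pair_pre_digraph" where
  "circulant_graph n S =
     \<lparr> pverts = {0..<n},
       parcs = {(u, v). \<exists>g\<in>{0..<n}. \<exists>s\<in>S. {u, v} = {g, (g + s) mod n}} \<rparr>"

definition graph_complement :: "'a pair_pre_digraph \<Rightarrow> 'a pair_pre_digraph" where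
  "graph_complement G =
     \<lparr> pverts = pverts G,
       parcs = {(u, v). u \<in> pverts G \<and> v \<in> pverts G \<and> u \<noteq> v \<and> (u, v) \<notin> parcs G} \<rparr>"

text \<open>Meaningful only if some path joins \<open>u\<close> to \<open>v\<close>. For \<open>u = v\<close> the empty path gives 0.\<close>

definition graph_distance :: "'a pair_pre_digraph \<Rightarrow> 'a \<Rightarrow> 'a \<Rightarrow> nat" where
  "graph_distance G u v = (LEAST k. \<exists>p. pre_digraph.apath (with_proj G) u p v \<and> length p = k)"

text \<open>The vertices \<open>v\<^sub>1, \<dots>, v\<^sub>n\<close> are listed in increasing order.\<close>

definition distance_matrix :: "'a::linorder pair_pre_digraph \<Rightarrow> real mat" where
  "distance_matrix G =
     (let vs = sorted_list_of_set (pverts G)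
      in mat (length vs) (length vs) (\<lambda>(i, j). real (graph_distance G (vs ! i) (vs ! j))))"

text \<open>
  The matrix is real symmetric, so all its eigenvalues are real and \<^const>\<open>spectrum\<close>, taken over
  the reals, contains all of them.
\<close>

definition distance_spectral_radius :: "'a::linorder pair_pre_digraph \<Rightarrow> real" where
  "distance_spectral_radius G = Max (spectrum (distance_matrix G))"

lemma pair_graph_circulant_graph:
  assumes "S \<subseteq> {1..<n}"
  shows "pair_graph (circulant_graph n S)"
proof -
  let ?G = "circulant_graph n S"
  have sub: "parcs ?G \<subseteq> {0..<n} \<times> {0..<n}"
    by (auto simp: circulant_graph_def doubleton_eq_iff)
  have ne: "(g + s) mod n \<noteq> g" if "g < n" "s \<in> S" for g s
  proof -
    have "s < n" "s > 0" using that assms by auto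
    with \<open>g < n\<close> show ?thesis
      by (cases "g + s < n") (auto simp: mod_if)
  qed
  have noloop: "fst e \<noteq> snd e" if e: "e \<in> parcs ?G" for e
  proof
    assume "fst e = snd e"
    with e obtain g s where "g < n" "s \<in> S" "{fst e} = {g, (g + s) mod n}"
      by (auto simp: circulant_graph_def)
    then show False using ne[of g s] by (metis insertI1 insert_subset singletonD subset_refl)
  qed
  have "sym (parcs ?G)"
    by (auto simp: circulant_graph_def sym_def insert_commute)
  moreover have "finite (parcs ?G)"
    using sub by (rule finite_subset) simp
  moreover have "pverts ?G = {0..<n}" by (simp add: circulant_graph_def)
  ultimately show ?thesis
    using sub noloop by unfold_locales (auto simp: symmetric_def)
qed

lemma pair_graph_graph_complement:
  assumes "pair_graph G"
  shows "pair_graph (graph_complement G)"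
proof -
  interpret pair_graph G by fact
  have "sym (parcs G)" using pair_sym_arcs by (simp add: symmetric_def)
  then have "sym (parcs (graph_complement G))"
    by (auto simp: graph_complement_def sym_def)
  moreover have "finite (parcs (graph_complement G))"
    by (rule finite_subset[of _ "pverts G \<times> pverts G"])
       (auto simp: graph_complement_def pair_finite_verts)
  ultimately show ?thesis
    by unfold_locales (auto simp: graph_complement_def symmetric_def pair_finite_verts)
qed

lemma finite_spectrum_distance_matrix: "finite (spectrum (distance_matrix G))"
  by (rule card_finite_spectrum(1)[where n = "length (sorted_list_of_set (pverts G))"])
     (simp add: distance_matrix_def Let_def)

end

theory Submission
  imports Defs
begin

text \<open>
  Only three features of the circulant graph matter: it is regular, of degree \<open>d = 2 * h\<close>, and it
  has more than \<open>2 * d\<close> vertices. In a \<open>d\<close>-regular graph on \<open>n > 2 * d\<close> vertices the two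
  neighbourhoods of the ends of an edge cannot cover all vertices, so the two ends have a common
  neighbour in the complement. Hence the complement is connected of diameter at most 2: its
  distances are 1 between distinct vertices that are not adjacent in the graph, and 2 between
  adjacent ones (\<open>graph_distance_complement\<close>). Each row of the distance matrix therefore has sum
  \<open>(n - 1 - d) + 2 * d = n - 1 + d\<close>.

  A nonnegative matrix with constant row sums \<open>r\<close> has the all-ones vector as an eigenvector for \<open>r\<close>,
  and no real eigenvalue exceeds \<open>r\<close>. So the distance spectral radius is \<open>n - 1 + d\<close>.

  For the circulant graph, the \<open>2 * h\<close> residues \<open>m ^ i\<close> and \<open>n - m ^ i\<close> are distinct because
  \<open>2 * m ^ i < n\<close>, which uses \<open>m \<ge> 3\<close>. The sparsity condition is \<open>4 * h < m ^ h\<close>, and the two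
  excluded pairs \<open>(3, 1)\<close> and \<open>(4, 1)\<close> are exactly those with \<open>m \<ge> 3\<close> and \<open>h \<ge> 1\<close> that violate it.
\<close>

section \<open>Nonnegative matrices with constant row sums\<close>

text \<open>
  Look at the row of an entry of largest absolute value of an eigenvector: there the eigenvalue
  equation bounds \<open>\<bar>e\<bar>\<close> by the row sum.
\<close>

lemma spectrum_le_row_sum:
  fixes A :: "real mat"
  assumes A: "A \<in> carrier_mat k k"
    and nonneg: "\<And>i j. i < k \<Longrightarrow> j < k \<Longrightarrow> 0 \<le> A $$ (i, j)"
    and row: "\<And>i. i < k \<Longrightarrow> (\<Sum>j<k. A $$ (i, j)) \<le> r"
    and ev: "e \<in> spectrum A"
  shows "e \<le> r"
proof -
  from ev A obtain v where v: "v \<in> carrier_vec k" "v \<noteq> 0\<^sub>v k" "A *\<^sub>v v = e \<cdot>\<^sub>v v"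
    by (auto simp: spectrum_def eigenvalue_def eigenvector_def)
  obtain l where l: "l < k" "v $ l \<noteq> 0"
    using v(1,2) by (metis carrier_vecD eq_vecI index_zero_vec)
  define M where "M = Max ((\<lambda>j. \<bar>v $ j\<bar>) ` {..<k})"
  have le_M: "\<bar>v $ j\<bar> \<le> M" if "j < k" for j
    unfolding M_def using that by (intro Max_ge) auto
  have "M \<in> (\<lambda>j. \<bar>v $ j\<bar>) ` {..<k}"
    unfolding M_def using l by (intro Max_in) auto
  then obtain i where i: "i < k" "M = \<bar>v $ i\<bar>" by auto
  have M_pos: "M > 0" using le_M[OF l(1)] l(2) by linarith
  have "(A *\<^sub>v v) $ i = (\<Sum>j<k. A $$ (i, j) * v $ j)"
    using A v(1) i(1) by (auto simp: scalar_prod_def atLeast0LessThan)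
  moreover have "(A *\<^sub>v v) $ i = e * v $ i"
    using v i(1) by (simp add: v(3))
  ultimately have "\<bar>e\<bar> * M = \<bar>\<Sum>j<k. A $$ (i, j) * v $ j\<bar>"
    unfolding i(2) abs_mult[symmetric] by simp
  also have "\<dots> \<le> (\<Sum>j<k. \<bar>A $$ (i, j) * v $ j\<bar>)" by (rule sum_abs)
  also have "\<dots> \<le> (\<Sum>j<k. A $$ (i, j) * M)"
    using nonneg[OF i(1)] le_M by (intro sum_mono) (simp add: abs_mult mult_left_mono)
  also have "\<dots> = (\<Sum>j<k. A $$ (i, j)) * M" by (simp add: sum_distrib_right)
  also have "\<dots> \<le> r * M" using row[OF i(1)] M_pos by (intro mult_right_mono) auto
  finally have "\<bar>e\<bar> \<le> r" using M_pos by simp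
  then show ?thesis by simp
qed

lemma row_sum_in_spectrum:
  fixes A :: "'a :: field mat"
  assumes A: "A \<in> carrier_mat k k" and "k > 0"
    and row: "\<And>i. i < k \<Longrightarrow> (\<Sum>j<k. A $$ (i, j)) = r"
  shows "r \<in> spectrum A"
proof -
  let ?one = "vec k (\<lambda>_. 1) :: 'a vec"
  have "A *\<^sub>v ?one = r \<cdot>\<^sub>v ?one"
    using A row by (intro eq_vecI) (auto simp: scalar_prod_def atLeast0LessThan)
  moreover have "?one \<noteq> 0\<^sub>v k"
    using \<open>k > 0\<close> by (metis index_vec index_zero_vec(1) zero_neq_one)
  ultimately show ?thesis
    using A unfolding spectrum_def eigenvalue_def eigenvector_def
    by (auto intro!: exI[of _ ?one])
qed

text \<open>
  The row sums of the distance matrix are the sums of all distances from a given vertex, whatever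
  the order in which the vertices are listed. If they all agree, their common value is the largest
  eigenvalue.
\<close>

lemma distance_spectral_radius_transmission_regular:
  assumes "finite (pverts G)" and "pverts G \<noteq> {}"
    and row: "\<And>u. u \<in> pverts G \<Longrightarrow> (\<Sum>v\<in>pverts G. graph_distance G u v) = r"
  shows "distance_spectral_radius G = real r"
proof -
  let ?vs = "sorted_list_of_set (pverts G)"
  let ?k = "length ?vs"
  let ?D = "distance_matrix G"
  have D: "?D \<in> carrier_mat ?k ?k"
    by (simp add: distance_matrix_def Let_def)
  have entry: "?D $$ (i, j) = real (graph_distance G (?vs ! i) (?vs ! j))"
      if "i < ?k" "j < ?k" for i j
    using that by (auto simp: distance_matrix_def Let_def)
  have bij: "bij_betw ((!) ?vs) {..<?k} (pverts G)"
    using assms(1) by (intro bij_betw_nth) auto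
  have row_D: "(\<Sum>j<?k. ?D $$ (i, j)) = real r" if i: "i < ?k" for i
  proof -
    have "(\<Sum>j<?k. ?D $$ (i, j)) = (\<Sum>j<?k. real (graph_distance G (?vs ! i) (?vs ! j)))"
      using i by (intro sum.cong) (simp_all add: entry)
    also have "\<dots> = (\<Sum>v\<in>pverts G. real (graph_distance G (?vs ! i) v))"
      by (rule sum.reindex_bij_betw[OF bij])
    also have "\<dots> = real (\<Sum>v\<in>pverts G. graph_distance G (?vs ! i) v)" by simp
    also have "\<dots> = real r"
      using row[of "?vs ! i"] i assms(1) nth_mem[OF i] by simp
    finally show ?thesis .
  qed
  have "?k > 0" using assms(1,2) by (simp add: card_gt_0_iff)
  show ?thesis
    unfolding distance_spectral_radius_def
  proof (rule Max_eqI)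
    show "finite (spectrum ?D)" by (rule finite_spectrum_distance_matrix)
    show "real r \<in> spectrum ?D"
      using D \<open>?k > 0\<close> row_D by (rule row_sum_in_spectrum)
    show "e \<le> real r" if "e \<in> spectrum ?D" for e
      using D _ _ that by (rule spectrum_le_row_sum) (simp add: entry, rule eq_refl[OF row_D])
  qed
qed

section \<open>Distances at most two\<close>

context pair_wf_digraph
begin

lemma graph_distance_self:
  assumes "u \<in> pverts G"
  shows "graph_distance G u u = 0"
  unfolding graph_distance_def using assms by (intro Least_equality) (auto simp: apath_Nil_iff)

lemma graph_distance_arc:
  assumes "(u, v) \<in> parcs G" and "u \<noteq> v"
  shows "graph_distance G u v = 1"
  unfolding graph_distance_def
proof (rule Least_equality)
  have "apath u [(u, v)] v"
    using assms arc_snd_in_verts[OF assms(1)] by (simp add: apath_Cons_iff apath_Nil_iff)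
  then show "\<exists>p. apath u p v \<and> length p = 1" by fastforce
  show "1 \<le> k" if "\<exists>p. apath u p v \<and> length p = k" for k
    using that assms(2) by (cases k) (auto simp: apath_Nil_iff)
qed

lemma graph_distance_common_neighbour:
  assumes "(u, w) \<in> parcs G" and "(w, v) \<in> parcs G"
    and "(u, v) \<notin> parcs G" and "u \<noteq> v"
  shows "graph_distance G u v = 2"
  unfolding graph_distance_def
proof (rule Least_equality)
  have "u \<noteq> w" "w \<noteq> v" using assms by auto
  then have "apath u [(u, w), (w, v)] v"
    using assms arc_snd_in_verts[OF assms(2)] by (simp add: apath_Cons_iff apath_Nil_iff)
  then show "\<exists>p. apath u p v \<and> length p = 2" by fastforce
  show "2 \<le> k" if k: "\<exists>p. apath u p v \<and> length p = k" for k
  proof (rule ccontr)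
    assume "\<not> 2 \<le> k"
    then have "k = 0 \<or> k = 1" by auto
    with k assms(3,4) show False
      by (auto simp: apath_Nil_iff apath_Cons_iff length_Suc_conv)
  qed
qed

end

section \<open>Complements of sparse regular graphs\<close>

text \<open>
  The bound \<open>2 * d\<close> is the largest possible size of the union of two neighbourhoods.
\<close>

locale sparse_regular_graph = pair_graph G for G :: "'a pair_pre_digraph" +
  fixes d :: nat
  assumes degree: "u \<in> pverts G \<Longrightarrow> card {v. (u, v) \<in> parcs G} = d"
    and sparse: "2 * d < card (pverts G)"
begin

abbreviation "nbrs u \<equiv> {v. (u, v) \<in> parcs G}"

lemma nbrs_subset: "nbrs u \<subseteq> pverts G"
  using arc_snd_in_verts by fastforce

text \<open>
  The neighbourhoods of \<open>u\<close> and \<open>v\<close> miss some vertex \<open>w\<close>. As \<open>u\<close> and \<open>v\<close> are adjacent, each lies in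
  the neighbourhood of the other, so \<open>w\<close> differs from both and is joined to both in the complement.
\<close>

lemma common_non_neighbour:
  assumes "(u, v) \<in> parcs G"
  obtains w where "(u, w) \<in> parcs (graph_complement G)" "(w, v) \<in> parcs (graph_complement G)"
proof -
  have uv: "u \<in> pverts G" "v \<in> pverts G" and vu: "(v, u) \<in> parcs G"
    using assms arc_fst_in_verts[OF assms] arc_snd_in_verts[OF assms] pair_sym_arcs
    by (auto simp: symmetric_def dest: symD)
  have sub: "nbrs u \<union> nbrs v \<subseteq> pverts G"
    using nbrs_subset by blast
  have "card (nbrs u \<union> nbrs v) \<le> card (nbrs u) + card (nbrs v)" by (rule card_Un_le)
  then have "card (nbrs u \<union> nbrs v) < card (pverts G)"
    using uv sparse by (simp add: degree)
  moreover have "finite (nbrs u \<union> nbrs v)"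
    using sub pair_finite_verts by (rule finite_subset)
  ultimately have "\<not> pverts G \<subseteq> nbrs u \<union> nbrs v"
    using card_mono[of "nbrs u \<union> nbrs v" "pverts G"] by linarith
  then obtain w where w: "w \<in> pverts G" "(u, w) \<notin> parcs G" "(v, w) \<notin> parcs G"
    by blast
  moreover have "(w, v) \<notin> parcs G"
    using w(3) pair_sym_arcs by (auto simp: symmetric_def dest: symD)
  moreover have "w \<noteq> u" "w \<noteq> v" using w assms vu by auto
  ultimately show thesis using that uv by (auto simp: graph_complement_def)
qed

text \<open>
  Writing the distance as a sum of two indicators makes the row sums immediate: the first
  indicator counts the vertices other than \<open>u\<close>, the second the neighbours of \<open>u\<close>.
\<close>

lemma graph_distance_complement:
  assumes "u \<in> pverts G" "v \<in> pverts G"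
  shows "graph_distance (graph_complement G) u v
           = (if v = u then 0 else 1) + (if (u, v) \<in> parcs G then 1 else 0)"
proof -
  interpret compl: pair_graph "graph_complement G"
    by (intro pair_graph_graph_complement pair_graph)
  have noloop: "(u, u) \<notin> parcs G" using pair_no_loops by force
  consider "v = u" | "v \<noteq> u" "(u, v) \<notin> parcs G" | "v \<noteq> u" "(u, v) \<in> parcs G" by blast
  then show ?thesis
  proof cases
    case 1
    then show ?thesis
      using assms noloop compl.graph_distance_self[of u] by (simp add: graph_complement_def)
  next
    case 2
    then show ?thesis
      using assms compl.graph_distance_arc[of u v] by (simp add: graph_complement_def)
  next
    case 3
    then obtain w where "(u, w) \<in> parcs (graph_complement G)" "(w, v) \<in> parcs (graph_complement G)"
      by (blast elim: common_non_neighbour)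
    moreover have "(u, v) \<notin> parcs (graph_complement G)"
      using 3 by (simp add: graph_complement_def)
    ultimately show ?thesis
      using 3 compl.graph_distance_common_neighbour[of u w v] by simp
  qed
qed

lemma connected_complement:
  "Digraph_Component.connected (with_proj (graph_complement G))"
proof -
  interpret compl: pair_graph "graph_complement G"
    by (intro pair_graph_graph_complement pair_graph)
  let ?H = "with_proj (graph_complement G)"
  have adj: "u \<rightarrow>\<^sup>*\<^bsub>?H\<^esub> v" if "(u, v) \<in> parcs (graph_complement G)" for u v
    using that by (intro compl.reachable_adjI) simp
  have "u \<rightarrow>\<^sup>*\<^bsub>?H\<^esub> v" if uv: "u \<in> pverts G" "v \<in> pverts G" for u v
  proof -
    consider "u = v" | "(u, v) \<in> parcs (graph_complement G)" | "(u, v) \<in> parcs G"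
      using uv by (auto simp: graph_complement_def)
    then show ?thesis
    proof cases
      case 1
      moreover have "v \<in> verts ?H" using uv by (simp add: graph_complement_def)
      ultimately show ?thesis by simp
    next
      case 2
      then show ?thesis by (rule adj)
    next
      case 3
      then obtain w where "(u, w) \<in> parcs (graph_complement G)" "(w, v) \<in> parcs (graph_complement G)"
        by (rule common_non_neighbour)
      then show ?thesis
        using adj by (blast intro: compl.reachable_trans)
    qed
  qed
  moreover have "pverts G \<noteq> {}" using sparse by auto
  ultimately have "strongly_connected ?H"
    by (intro strongly_connectedI) (auto simp: graph_complement_def)
  then have "strongly_connected (mk_symmetric ?H)"
    by (auto simp: strongly_connected_def intro: compl.reachable_mk_symmetricI)
  then show ?thesis unfolding connected_def .
qed

lemma transmission_complement:
  assumes "u \<in> pverts G"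
  shows "(\<Sum>v\<in>pverts G. graph_distance (graph_complement G) u v) = card (pverts G) - 1 + d"
proof -
  have "(\<Sum>v\<in>pverts G. graph_distance (graph_complement G) u v)
      = (\<Sum>v\<in>pverts G. if v = u then 0 else 1) + (\<Sum>v\<in>pverts G. if (u, v) \<in> parcs G then 1 else 0)"
    using assms by (simp add: graph_distance_complement sum.distrib)
  also have "(\<Sum>v\<in>pverts G. if v = u then 0 else 1 :: nat) = card (pverts G - {u})"
    by (simp add: sum.If_cases Diff_eq)
  also have "\<dots> = card (pverts G) - 1"
    using assms by (simp add: card_Diff_singleton)
  also have "(\<Sum>v\<in>pverts G. if (u, v) \<in> parcs G then 1 else 0 :: nat) = card (pverts G \<inter> nbrs u)"
    by (simp add: sum.If_cases)
  also have "pverts G \<inter> nbrs u = nbrs u"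
    using nbrs_subset by blast
  finally show ?thesis using degree[OF assms] by simp
qed

end

theorem distance_spectral_radius_complement_regular:
  fixes G :: "'a::linorder pair_pre_digraph"
  assumes "sparse_regular_graph G d"
  shows "distance_spectral_radius (graph_complement G) = real (card (pverts G)) + real d - 1"
proof -
  interpret sparse_regular_graph G d by fact
  have verts: "pverts (graph_complement G) = pverts G"
    by (simp add: graph_complement_def)
  have pos: "card (pverts G) > 0" using sparse by simp
  have "distance_spectral_radius (graph_complement G) = real (card (pverts G) - 1 + d)"
    using pos transmission_complement
    by (intro distance_spectral_radius_transmission_regular)
       (auto simp: verts pair_finite_verts card_gt_0_iff)
  then show ?thesis using pos by simp
qed

section \<open>The degree of a circulant graph\<close>

text \<open>
  An edge \<open>{g, g + s}\<close> contains \<open>u\<close> either as \<open>g\<close>, with other end \<open>u + s\<close>, or as \<open>g + s\<close>, with other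
  end \<open>u - s\<close>; modulo \<open>n\<close> the latter is \<open>u + (n - s)\<close>, which avoids negative numbers.
\<close>

lemma circulant_graph_nbrs:
  assumes S: "S \<subseteq> {1..<n}" and u: "u < n"
  shows "{v. (u, v) \<in> parcs (circulant_graph n S)}
           = (\<lambda>t. (u + t) mod n) ` (S \<union> (\<lambda>s. n - s) ` S)"
proof -
  have cancel: "((x + a) mod n + b) mod n = x" if "x < n" "a + b = n" for x a b
    using that by (simp add: mod_add_left_eq add.assoc)
  have minus: "(u + (n - s)) mod n = v \<longleftrightarrow> u = (v + s) mod n" if "s \<in> S" "v < n" for s v
  proof -
    have "s + (n - s) = n" "(n - s) + s = n" using that(1) S by auto
    then show ?thesis
      using cancel[of u "n - s" s] cancel[of v s "n - s"] u that(2) by metis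
  qed
  have "(u, v) \<in> parcs (circulant_graph n S)
      \<longleftrightarrow> (\<exists>s\<in>S. v = (u + s) mod n) \<or> (v < n \<and> (\<exists>s\<in>S. u = (v + s) mod n))" for v
    unfolding circulant_graph_def using u by (auto simp: doubleton_eq_iff)
  moreover have "v < n \<and> (\<exists>s\<in>S. u = (v + s) mod n) \<longleftrightarrow> (\<exists>s\<in>S. v = (u + (n - s)) mod n)" for v
    using minus u by (metis gr_zeroI mod_less_divisor not_less_zero)
  ultimately show ?thesis by auto
qed

text \<open>
  If all elements of \<open>S\<close> are below \<open>n / 2\<close>, then all elements \<open>n - s\<close> are above it, so the
  \<open>2 * card S\<close> translations in the previous lemma are all different.
\<close>

lemma circulant_graph_degree:
  assumes S: "\<And>s. s \<in> S \<Longrightarrow> 0 < s \<and> 2 * s < n" and u: "u < n"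
  shows "card {v. (u, v) \<in> parcs (circulant_graph n S)} = 2 * card S"
proof -
  let ?T = "S \<union> (\<lambda>s. n - s) ` S"
  have S_sub: "S \<subseteq> {1..<n}" using S by force
  have T_sub: "?T \<subseteq> {..<n}" using S by force
  have fin: "finite S" using S_sub by (rule finite_subset) simp
  have inj: "inj_on (\<lambda>t. (u + t) mod n) {..<n}"
    using u by (intro inj_onI) (auto simp: mod_if split: if_splits)
  have "card {v. (u, v) \<in> parcs (circulant_graph n S)} = card ?T"
    unfolding circulant_graph_nbrs[OF S_sub u]
    by (rule card_image) (rule inj_on_subset[OF inj T_sub])
  also have "\<dots> = card S + card ((\<lambda>s. n - s) ` S)"
    using fin by (intro card_Un_disjoint) (auto dest!: S)
  also have "card ((\<lambda>s. n - s) ` S) = card S"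
    using S_sub by (intro card_image inj_onI) (auto dest!: S)
  finally show ?thesis by simp
qed

section \<open>The circulant graph on the powers of m\<close>

text \<open>
  For \<open>h = 1\<close> the claim is \<open>m > 4\<close>. For \<open>h \<ge> 2\<close> already \<open>3 ^ h\<close> exceeds \<open>4 * h\<close>, starting from
  \<open>9 > 8\<close>.
\<close>

lemma four_mult_less_power:
  fixes m h :: nat
  assumes "m \<ge> 3" and "h \<ge> 1" and "(m, h) \<notin> {(3, 1), (4, 1)}"
  shows "4 * h < m ^ h"
proof (cases "h = 1")
  case True
  then show ?thesis using assms by auto
next
  case False
  then have "2 \<le> h" using assms by simp
  then have "4 * h < 3 ^ h"
    by (induction h rule: dec_induct) auto
  also have "\<dots> \<le> m ^ h" using assms(1) by (rule power_mono) simp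
  finally show ?thesis .
qed

theorem theorem5p5:
  fixes m h n :: nat
  assumes "m \<ge> 3" and "h \<ge> 1" and "(m, h) \<notin> {(3, 1), (4, 1)}"
    and "n = m ^ h"
  shows "Digraph_Component.connected
           (with_proj (graph_complement (circulant_graph n ((\<lambda>i. m ^ i) ` {0..<h}))))
       \<and> distance_spectral_radius
           (graph_complement (circulant_graph n ((\<lambda>i. m ^ i) ` {0..<h})))
         = real n + 2 * real h - 1"
proof -
  let ?S = "(\<lambda>i. m ^ i) ` {0..<h}"
  let ?G = "circulant_graph n ?S"
  have S: "0 < s \<and> 2 * s < n" if "s \<in> ?S" for s
  proof -
    from that obtain i where i: "i < h" "s = m ^ i" by auto
    have "2 * s < m ^ Suc i" using assms(1) by (simp add: i(2))
    also have "\<dots> \<le> n"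
      unfolding assms(4) using i(1) assms(1) by (intro power_increasing) auto
    finally show ?thesis using assms(1) i(2) by simp
  qed
  have card_S: "card ?S = h"
    using assms(1) by (subst card_image) (auto intro!: inj_onI)
  have verts: "pverts ?G = {0..<n}" by (simp add: circulant_graph_def)
  have "pair_graph ?G"
    using S by (intro pair_graph_circulant_graph) force
  then interpret pair_graph ?G .
  have regular: "sparse_regular_graph ?G (2 * h)"
  proof
    show "card {v. (u, v) \<in> parcs ?G} = 2 * h" if "u \<in> pverts ?G" for u
      using circulant_graph_degree[of ?S n u] S card_S that verts by auto
    show "2 * (2 * h) < card (pverts ?G)"
      using four_mult_less_power[OF assms(1-3)] unfolding verts by (simp add: assms(4))
  qed
  show ?thesis
    using sparse_regular_graph.connected_complement[OF regular]
      distance_spectral_radius_complement_regular[OF regular]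
    by (simp add: verts)
qed

end
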